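(* Let $V$ be a finite-dimensional complex vector space, $B\subset V^*$ a finite spanning multiset of nonzero vectors, $\mathcal{H}=\mathcal{H}_B$ the central arrangement in $V$ defined by $B$, and $\mathcal{H}^c_B\subset(\mathbb{C}^\times)^B$ the image of $V\smallsetminus\mathcal{H}$ under $v\mapsto(\langle b,v\rangle)_{b\in B}$. Let $\mathcal{L}$ be a flag of flats of $\mathcal{H}$ and let $\omega\in\mathbb{Z}^B$ be a weight lying in the relative interior of the cone $\sigma_{\mathcal{L}}$. Then $$\mathrm{in}_\omega\mathcal{H}_B^c=\mathcal{H}(\mathcal{L})^c.$$
   Context: A flat of $\mathcal{H}$ is a linear subspace of $V$ that is an intersection of hyperplanes of $\mathcal{H}$. A flag of flats is $\mathcal{L}=(\{0\}=L_0\subsetneq L_1\subsetneq\dots\subsetneq L_k\subsetneq L_{k+1}=V)$ with each $L_i$ a flat; put $F_i=\{b\in B:b|_{L_i}\equiv0\}$, so $B=F_0\supsetneq F_1\supsetneq\dots\supsetneq F_{k+1}=\emptyset$. $\sigma_{\mathcal{L}}\subset\mathbb{R}^B$ is the cone whose relative interior consists of the functions $\omega\colon B\to\mathbb{R}$ that are constant on each $F_{i-1}\smallsetminus F_i$ ($1\le i\le k+1$) and satisfy $\omega|_{F_i\smallsetminus F_{i+1}}>\omega|_{F_{i-1}\smallsetminus F_i}$ for $1\le i\le k$. For $1\le i\le k+1$ the forms in $F_{i-1}\smallsetminus F_i$ induce an arrangement $(\mathcal{H}/L_{i-1})|_{L_i}$ in $L_i/L_{i-1}$; $((\mathcal{H}/L_{i-1})|_{L_i})^c\subset(\mathbb{C}^\times)^{F_{i-1}\smallsetminus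 F_i}$ is the image of its complement under $v\mapsto(\langle b,v\rangle)_{b\in F_{i-1}\smallsetminus F_i}$, and $\mathcal{H}(\mathcal{L})^c:=\prod_{i=1}^{k+1}((\mathcal{H}/L_{i-1})|_{L_i})^c\subset(\mathbb{C}^\times)^B$. Initial scheme: $\omega\in\mathbb{Z}^B$ is identified with the cocharacter $t\mapsto(t^{\omega(b)})_{b\in B}$. For $X\subset(\mathbb{C}^\times)^B$ let $\mathcal{X}(\omega)=\{(t,x)\in\mathbb{C}^\times\times(\mathbb{C}^\times)^B:\omega(t)\cdot x\in X\}$; $\mathrm{in}_\omega X$ is the fiber over $0\in\mathbb{C}$ of the closure of $\mathcal{X}(\omega)$ in $\mathbb{C}\times(\mathbb{C}^\times)^B$ (equivalently, the limit of $\omega(t)\cdot X$ as $t\to\infty$). *)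

theory Defs
  imports
    Complex_Main
    "HOL-Library.FuncSet"
    "HOL-Library.Function_Algebras"
    "HOL-Library.Poly_Mapping"
    "HOL-Computational_Algebra.Polynomial"
begin

text \<open>
  The multiset \<open>B\<close> is a family \<open>\<beta> :: 'b \<Rightarrow> 'v \<Rightarrow> complex\<close> of linear forms indexed by a finite
  type, so repetitions are allowed and \<open>\<complex>\<^sup>B\<close> is the type \<open>'b \<Rightarrow> complex\<close>. Nonemptiness of the index
  type loses nothing: a flag of flats forces \<open>V \<noteq> 0\<close>, and then a spanning multiset is nonempty.
\<close>

definition dual :: "(complex \<Rightarrow> 'v \<Rightarrow> 'v) \<Rightarrow> ('v::ab_group_add \<Rightarrow> complex) set" where
  "dual scale = {f. Vector_Spaces.linear scale (*) f}"

definition dual_span :: "('v \<Rightarrow> complex) set \<Rightarrow> ('v \<Rightarrow> complex) set" where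
  "dual_span = module.span (\<lambda>(c::complex) f v. c * f v)"

definition hyperplane :: "'w set \<Rightarrow> ('w \<Rightarrow> complex) \<Rightarrow> 'w set" where
  "hyperplane W f = {w \<in> W. f w = 0}"

text \<open>
  For forms \<open>f b\<close> (\<open>b \<in> S\<close>) on a space with carrier \<open>W\<close>: the complement of the hyperplanes they
  define, and its image in \<open>(\<complex>\<^sup>\<times>)\<^sup>S\<close>, whose elements are functions that are \<open>undefined\<close> outside \<open>S\<close>.
\<close>

definition arrangement_complement :: "'w set \<Rightarrow> 'b set \<Rightarrow> ('b \<Rightarrow> 'w \<Rightarrow> complex) \<Rightarrow> 'w set" where
  "arrangement_complement W S f = W - (\<Union>b\<in>S. hyperplane W (f b))"

definition complement_image ::
    "'w set \<Rightarrow> 'b set \<Rightarrow> ('b \<Rightarrow> 'w \<Rightarrow> complex) \<Rightarrow> ('b \<Rightarrow> complex) set" where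
  "complement_image W S f = (\<lambda>w. restrict (\<lambda>b. f b w) S) ` arrangement_complement W S f"

definition is_flat :: "('b \<Rightarrow> 'v \<Rightarrow> complex) \<Rightarrow> 'v set \<Rightarrow> bool" where
  "is_flat \<beta> L \<longleftrightarrow> (\<exists>A \<subseteq> range (\<lambda>b. hyperplane UNIV (\<beta> b)). L = \<Inter>A)"

text \<open>The members \<open>L 0, \<dots>, L (k + 1)\<close> of a flag; other values of \<open>L\<close> are irrelevant.\<close>

definition is_flag ::
    "('b \<Rightarrow> 'v::ab_group_add \<Rightarrow> complex) \<Rightarrow> nat \<Rightarrow> (nat \<Rightarrow> 'v set) \<Rightarrow> bool" where
  "is_flag \<beta> k L \<longleftrightarrow>
     L 0 = {0} \<and> L (k + 1) = UNIV \<and>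
     (\<forall>i \<le> k. L i \<subset> L (i + 1)) \<and> (\<forall>i \<le> k + 1. is_flat \<beta> (L i))"

definition flag_forms :: "('b \<Rightarrow> 'v \<Rightarrow> complex) \<Rightarrow> (nat \<Rightarrow> 'v set) \<Rightarrow> nat \<Rightarrow> 'b set" where
  "flag_forms \<beta> L i = {b. \<forall>v \<in> L i. \<beta> b v = 0}"

definition flag_block :: "('b \<Rightarrow> 'v \<Rightarrow> complex) \<Rightarrow> (nat \<Rightarrow> 'v set) \<Rightarrow> nat \<Rightarrow> 'b set" where
  "flag_block \<beta> L i = flag_forms \<beta> L (i - 1) - flag_forms \<beta> L i"

definition flag_cone_relint ::
    "('b \<Rightarrow> 'v \<Rightarrow> complex) \<Rightarrow> nat \<Rightarrow> (nat \<Rightarrow> 'v set) \<Rightarrow> ('b \<Rightarrow> real) set" where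
  "flag_cone_relint \<beta> k L =
     {\<omega>. (\<forall>i \<in> {1..k + 1}. \<forall>b \<in> flag_block \<beta> L i. \<forall>b' \<in> flag_block \<beta> L i. \<omega> b = \<omega> b') \<and>
         (\<forall>i \<in> {1..k}. \<forall>b \<in> flag_block \<beta> L (i + 1). \<forall>b' \<in> flag_block \<beta> L i. \<omega> b > \<omega> b')}"

text \<open>
  The quotient \<open>L / L'\<close> is the set of cosets. A form that vanishes on \<open>L'\<close> is constant on each coset,
  and \<open>induced_form\<close> is that constant value.
\<close>

definition quotient_space :: "'v::ab_group_add set \<Rightarrow> 'v set \<Rightarrow> 'v set set" where
  "quotient_space L L' = L // {(u, v). u \<in> L \<and> v \<in> L \<and> u - v \<in> L'}"

definition induced_form :: "('v \<Rightarrow> complex) \<Rightarrow> 'v set \<Rightarrow> complex" where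
  "induced_form f C = the_elem (f ` C)"

text \<open>
  The product of the \<open>k + 1\<close> complements, inside \<open>(\<complex>\<^sup>\<times>)\<^sup>B\<close> viewed as the product of the tori on the
  blocks (which partition \<open>B\<close>).
\<close>

definition flag_complement ::
    "('b \<Rightarrow> 'v::ab_group_add \<Rightarrow> complex) \<Rightarrow> nat \<Rightarrow> (nat \<Rightarrow> 'v set) \<Rightarrow> ('b \<Rightarrow> complex) set" where
  "flag_complement \<beta> k L =
     {x. \<forall>i \<in> {1..k + 1}.
           restrict x (flag_block \<beta> L i) \<in>
             complement_image (quotient_space (L i) (L (i - 1))) (flag_block \<beta> L i)
               (\<lambda>b. induced_form (\<beta> b))}"

text \<open>
  A closed subscheme of \<open>(\<complex>\<^sup>\<times>)\<^sup>B\<close> is an ideal of the ring \<open>\<complex>[x\<^sub>b\<^sup>\<plusminus>]\<close> of Laurent polynomials, and a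
  closed subscheme of \<open>\<complex> \<times> (\<complex>\<^sup>\<times>)\<^sup>B\<close> is an ideal of \<open>\<complex>[x\<^sub>b\<^sup>\<plusminus>][t]\<close>. A subvariety is given by its set of
  closed points and carries the reduced structure, that is, its vanishing ideal.
\<close>

type_synonym 'b laurent = "('b \<Rightarrow> int) \<Rightarrow>\<^sub>0 complex"

definition torus :: "('b \<Rightarrow> complex) set" where
  "torus = {x. \<forall>b. x b \<noteq> 0}"

definition laurent_eval :: "('b::finite \<Rightarrow> complex) \<Rightarrow> 'b laurent \<Rightarrow> complex" where
  "laurent_eval x p =
     (\<Sum>m \<in> Poly_Mapping.keys p. Poly_Mapping.lookup p m * (\<Prod>b\<in>UNIV. x b powi m b))"

definition family_eval :: "complex \<Rightarrow> ('b::finite \<Rightarrow> complex) \<Rightarrow> 'b laurent poly \<Rightarrow> complex" where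
  "family_eval t x g = poly (map_poly (laurent_eval x) g) t"

definition torus_ideal :: "('b::finite \<Rightarrow> complex) set \<Rightarrow> 'b laurent set" where
  "torus_ideal X = {p. \<forall>x \<in> X. laurent_eval x p = 0}"

definition family_ideal :: "(complex \<times> ('b::finite \<Rightarrow> complex)) set \<Rightarrow> 'b laurent poly set" where
  "family_ideal Z = {g. \<forall>(t, x) \<in> Z. family_eval t x g = 0}"

definition zariski_closure ::
    "(complex \<times> ('b::finite \<Rightarrow> complex)) set \<Rightarrow> (complex \<times> ('b \<Rightarrow> complex)) set" where
  "zariski_closure Z = {(t, x). x \<in> torus \<and> (\<forall>g \<in> family_ideal Z. family_eval t x g = 0)}"

definition degeneration ::
    "('b \<Rightarrow> int) \<Rightarrow> ('b \<Rightarrow> complex) set \<Rightarrow> (complex \<times> ('b \<Rightarrow> complex)) set" where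
  "degeneration \<omega> X = {(t, x). t \<noteq> 0 \<and> x \<in> torus \<and> (\<lambda>b. t powi \<omega> b * x b) \<in> X}"

text \<open>
  The fiber over \<open>t = 0\<close> of the closure of the degeneration: its closed points, and its ideal, which
  is the image of the ideal of the closure under the specialization \<open>t \<mapsto> 0\<close>. The ideal may be
  non-radical, so the closed points alone do not determine the initial scheme.
\<close>

definition initial_points ::
    "('b::finite \<Rightarrow> int) \<Rightarrow> ('b \<Rightarrow> complex) set \<Rightarrow> ('b \<Rightarrow> complex) set" where
  "initial_points \<omega> X = {x. (0, x) \<in> zariski_closure (degeneration \<omega> X)}"

definition initial_ideal :: "('b::finite \<Rightarrow> int) \<Rightarrow> ('b \<Rightarrow> complex) set \<Rightarrow> 'b laurent set" where
  "initial_ideal \<omega> X = (\<lambda>g. poly g 0) ` family_ideal (degeneration \<omega> X)"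

end

theory Submission
  imports Defs
begin

text \<open>
  The complement is the torus part of a linear subspace \<open>W\<close> of \<open>\<complex>\<^sup>B\<close>, the image of \<open>V\<close> under
  \<open>v \<mapsto> (\<beta> b v)\<^sub>b\<close>. Any such \<open>W\<close> and any weight admit a projector \<open>E\<close> of \<open>\<complex>\<^sup>B\<close> onto \<open>W\<close> whose entry
  \<open>E b c\<close> vanishes when \<open>\<omega> c < \<omega> b\<close> (\<open>triangular_dual_frame\<close>). Conjugating \<open>E\<close> by the torus
  element \<open>\<omega>(t)\<close> gives a projector \<open>E\<^sub>t\<close> onto \<open>\<omega>(t)\<^sup>-\<^sup>1 W\<close>; its entries
  \<open>E b c * t ^ (\<omega> c - \<omega> b)\<close> are polynomial in \<open>t\<close>, so the family of projectors extends over \<open>t = 0\<close>,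
  where it becomes the part of \<open>E\<close> that preserves the weight.

  The limit scheme is therefore the torus part of the range of \<open>E\<^sub>0\<close>, with its reduced structure.
  A function in the ideal of the family vanishes along each curve \<open>t \<mapsto> E\<^sub>t x\<close> with \<open>E\<^sub>0 x = x\<close>, and
  hence at its limit point \<open>x\<close> (\<open>family_ideal_specializes\<close>). Conversely, the substitution
  \<open>x \<mapsto> x + E\<^sub>0 x - E\<^sub>t x\<close> is the identity at \<open>t = 0\<close> and carries the range of \<open>E\<^sub>t\<close> into the range of
  \<open>E\<^sub>0\<close>, so it turns a Laurent polynomial that vanishes on the limit into an element of the
  ideal of the family that specializes to it (\<open>torus_ideal_lifts\<close>). This gives the equality of
  ideals, and the closed points follow because the limit is closed in the torus.

  Flags enter only through the identification of the range of \<open>E\<^sub>0\<close>. In the relative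
  interior of the cone, the blocks of the flag are the level sets of \<open>\<omega>\<close>, and the forms
  vanishing on \<open>L i\<close> are those of larger weight than the \<open>i\<close>-th block (\<open>weight_determines_flag\<close>).
  So the vectors of the frame that belong to the block lie in \<open>L i\<close>, and \<open>E\<^sub>0\<close> restricts on the
  block to a projector onto the values there of the forms at vectors of \<open>L i\<close>.
\<close>

section \<open>Evaluation of Laurent polynomials\<close>

lemma laurent_eval_superset:
  assumes "finite K" "Poly_Mapping.keys p \<subseteq> K"
  shows "laurent_eval x p = (\<Sum>m\<in>K. Poly_Mapping.lookup p m * (\<Prod>b\<in>UNIV. x b powi m b))"
  unfolding laurent_eval_def
  by (rule sum.mono_neutral_left) (use assms in \<open>auto simp: in_keys_iff\<close>)

lemma laurent_eval_0 [simp]: "laurent_eval x 0 = 0"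
  by (simp add: laurent_eval_def)

lemma laurent_eval_single [simp]:
  "laurent_eval x (Poly_Mapping.single m c) = c * (\<Prod>b\<in>UNIV. x b powi m b)"
  by (subst laurent_eval_superset[of "{m}"]) auto

lemma laurent_eval_add: "laurent_eval x (p + q) = laurent_eval x p + laurent_eval x q"
proof -
  let ?K = "Poly_Mapping.keys p \<union> Poly_Mapping.keys q"
  have "finite ?K" "Poly_Mapping.keys (p + q) \<subseteq> ?K"
    by (simp_all add: Poly_Mapping.keys_add)
  then show ?thesis
    by (simp add: laurent_eval_superset[of ?K] lookup_add ring_distribs sum.distrib)
qed

lemma laurent_eval_uminus: "laurent_eval x (- p) = - laurent_eval x p"
  using laurent_eval_add[of x p "- p"] by (simp add: eq_neg_iff_add_eq_0 add.commute)

lemma laurent_eval_diff: "laurent_eval x (p - q) = laurent_eval x p - laurent_eval x q"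
  using laurent_eval_add[of x p "- q"] by (simp add: laurent_eval_uminus)

lemma laurent_eval_sum: "laurent_eval x (\<Sum>i\<in>I. f i) = (\<Sum>i\<in>I. laurent_eval x (f i))"
  by (induction I rule: infinite_finite_induct) (auto simp: laurent_eval_add)

lemma sum_single_lookup:
  "(\<Sum>m\<in>Poly_Mapping.keys p. Poly_Mapping.single m (Poly_Mapping.lookup p m)) = p"
  by (rule poly_mapping_eqI)
     (auto simp: lookup_sum lookup_single when_def in_keys_iff sum.delta)

lemma laurent_eval_single_mult:
  assumes "x \<in> torus"
  shows "laurent_eval x (Poly_Mapping.single m c * q) =
    laurent_eval x (Poly_Mapping.single m c) * laurent_eval x q"
proof -
  have "laurent_eval x (Poly_Mapping.single m c * q) =
      laurent_eval x (\<Sum>n\<in>Poly_Mapping.keys q.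
        Poly_Mapping.single m c * Poly_Mapping.single n (Poly_Mapping.lookup q n))"
    by (simp flip: sum_distrib_left add: sum_single_lookup)
  also have "\<dots> = (\<Sum>n\<in>Poly_Mapping.keys q. (c * (\<Prod>b\<in>UNIV. x b powi m b)) *
      (Poly_Mapping.lookup q n * (\<Prod>b\<in>UNIV. x b powi n b)))"
    using assms
    by (simp add: laurent_eval_sum mult_single torus_def power_int_add prod.distrib mult_ac)
  also have "\<dots> = laurent_eval x (Poly_Mapping.single m c) * laurent_eval x q"
    by (simp add: laurent_eval_def flip: sum_distrib_left)
  finally show ?thesis .
qed

lemma laurent_eval_mult:
  assumes "x \<in> torus"
  shows "laurent_eval x (p * q) = laurent_eval x p * laurent_eval x q"
proof -
  have "laurent_eval x (p * q) = laurent_eval x (\<Sum>m\<in>Poly_Mapping.keys p.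
      Poly_Mapping.single m (Poly_Mapping.lookup p m) * q)"
    by (simp flip: sum_distrib_right add: sum_single_lookup)
  also have "\<dots> = (\<Sum>m\<in>Poly_Mapping.keys p.
      laurent_eval x (Poly_Mapping.single m (Poly_Mapping.lookup p m))) * laurent_eval x q"
    by (simp only: laurent_eval_sum laurent_eval_single_mult[OF assms] sum_distrib_right)
  also have "\<dots> = laurent_eval x p * laurent_eval x q"
    by (simp only: sum_single_lookup flip: laurent_eval_sum)
  finally show ?thesis .
qed

lemma tendsto_laurent_eval:
  assumes "\<And>b. ((\<lambda>t. y t b) \<longlongrightarrow> x b) F" "x \<in> torus"
  shows "((\<lambda>t. laurent_eval (y t) p) \<longlongrightarrow> laurent_eval x p) F"
  unfolding laurent_eval_def using assms by (intro tendsto_intros) (auto simp: torus_def)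

definition coordinate_term :: "'b \<Rightarrow> complex \<Rightarrow> 'b laurent" where
  "coordinate_term b c = Poly_Mapping.single (\<lambda>b'. if b' = b then 1 else 0) c"

lemma laurent_eval_coordinate_term [simp]: "laurent_eval x (coordinate_term b c) = c * x b"
proof -
  have "(\<Prod>b'\<in>UNIV. x b' powi (if b' = b then 1 else 0)) =
      (\<Prod>b'\<in>UNIV. if b' = b then x b' else 1)"
    by (rule prod.cong) auto
  then show ?thesis
    by (simp add: coordinate_term_def)
qed

lemma coordinate_term_0 [simp]: "coordinate_term b 0 = 0"
  by (simp add: coordinate_term_def)

lemma coordinate_term_power:
  "coordinate_term b 1 ^ n = Poly_Mapping.single (\<lambda>b'. if b' = b then int n else 0) 1"
proof (induction n)
  case 0
  have "(\<lambda>b'. if b' = b then int 0 else 0) = 0" by auto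
  then show ?case by (metis power_0 single_one)
next
  case (Suc n)
  then show ?case
    by (auto simp: coordinate_term_def mult_single fun_eq_iff intro!: arg_cong2[where f = Poly_Mapping.single])
qed

lemma prod_coordinate_term_power:
  fixes n :: "'b::finite \<Rightarrow> nat"
  shows "(\<Prod>b\<in>UNIV. coordinate_term b 1 ^ n b) = Poly_Mapping.single (\<lambda>b. int (n b)) 1"
proof -
  have "(\<Prod>b\<in>S. coordinate_term b 1 ^ n b) =
      Poly_Mapping.single (\<lambda>b. if b \<in> S then int (n b) else 0) 1" for S :: "'b set"
    using finite[of S]
  proof (induction S)
    case empty
    then show ?case by (simp flip: zero_fun_def)
  next
    case (insert a S)
    then show ?case
      by (auto simp: coordinate_term_power mult_single fun_eq_iff intro!: arg_cong2[where f = Poly_Mapping.single])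
  qed
  from this[of UNIV] show ?thesis by simp
qed

section \<open>Evaluation of one-parameter families\<close>

lemma family_eval_0 [simp]: "family_eval t x 0 = 0"
  by (simp add: family_eval_def)

lemma family_eval_pCons [simp]:
  "family_eval t x (pCons a g) = laurent_eval x a + t * family_eval t x g"
  by (simp add: family_eval_def map_poly_pCons)

lemma family_eval_add: "family_eval t x (g + h) = family_eval t x g + family_eval t x h"
proof (induction g arbitrary: h)
  case (pCons a g)
  then show ?case by (cases h) (simp add: laurent_eval_add algebra_simps)
qed simp

lemma family_eval_uminus: "family_eval t x (- g) = - family_eval t x g"
  using family_eval_add[of t x g "- g"] by (simp add: eq_neg_iff_add_eq_0 add.commute)

lemma family_eval_diff: "family_eval t x (g - h) = family_eval t x g - family_eval t x h"
  using family_eval_add[of t x g "- h"] by (simp add: family_eval_uminus)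

lemma family_eval_sum: "family_eval t x (\<Sum>i\<in>I. f i) = (\<Sum>i\<in>I. family_eval t x (f i))"
  by (induction I rule: infinite_finite_induct) (auto simp: family_eval_add)

lemma family_eval_smult:
  "x \<in> torus \<Longrightarrow> family_eval t x (smult a g) = laurent_eval x a * family_eval t x g"
  by (induction g) (auto simp: laurent_eval_mult algebra_simps)

lemma family_eval_mult:
  assumes "x \<in> torus"
  shows "family_eval t x (g * h) = family_eval t x g * family_eval t x h"
  by (induction g) (auto simp: family_eval_add family_eval_smult[OF assms] algebra_simps)

lemma family_eval_1 [simp]: "family_eval t x 1 = 1"
  by (simp add: one_pCons flip: single_one)

lemma family_eval_power:
  "x \<in> torus \<Longrightarrow> family_eval t x (g ^ n) = family_eval t x g ^ n"
  by (induction n) (auto simp: family_eval_mult)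

lemma family_eval_prod:
  "x \<in> torus \<Longrightarrow> family_eval t x (\<Prod>i\<in>I. f i) = (\<Prod>i\<in>I. family_eval t x (f i))"
  by (induction I rule: infinite_finite_induct) (auto simp: family_eval_mult)

lemma family_eval_monom: "family_eval t x (monom a n) = laurent_eval x a * t ^ n"
  by (induction n) (auto simp: monom_0 monom_Suc)

lemma family_eval_at_0: "family_eval 0 x g = laurent_eval x (poly g 0)"
  by (cases g) simp

lemma tendsto_family_eval:
  assumes "(s \<longlongrightarrow> t) F" "\<And>b. ((\<lambda>u. y u b) \<longlongrightarrow> x b) F" "x \<in> torus"
  shows "((\<lambda>u. family_eval (s u) (y u) g) \<longlongrightarrow> family_eval t x g) F"
proof (induction g)
  case (pCons a g)
  then show ?case
    by (auto intro!: tendsto_intros tendsto_laurent_eval assms)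
qed simp

section \<open>Dual frames that are triangular for a weight\<close>

text \<open>
  The first conclusion says that \<open>v - (\<Sum>b\<in>S. \<beta> b v \<cdot> q b)\<close> is killed by all the forms: the \<open>q b\<close> are a
  dual frame modulo the common kernel. Forms are added in order of decreasing weight. If the
  new form \<open>\<beta> a\<close> is not already determined by the earlier ones, it takes the value \<open>1\<close> at some \<open>u\<close> in
  their common kernel; \<open>u\<close> becomes the new frame vector, and subtracting multiples of \<open>u\<close> from the
  earlier ones moves them into the kernel of \<open>\<beta> a\<close> without affecting the earlier forms. So every frame
  vector stays in the kernel of the forms of larger weight.
\<close>

lemma triangular_dual_frame:
  fixes \<beta> :: "'b \<Rightarrow> 'v::ab_group_add \<Rightarrow> complex" and \<omega> :: "'b \<Rightarrow> int"
  assumes lin: "\<And>b. Vector_Spaces.linear scale (*) (\<beta> b)" and "finite S"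
  shows "\<exists>q. (\<forall>v. \<forall>c\<in>S. \<beta> c v = (\<Sum>b\<in>S. \<beta> b v * \<beta> c (q b))) \<and>
             (\<forall>b\<in>S. \<forall>c\<in>S. \<omega> b < \<omega> c \<longrightarrow> \<beta> c (q b) = 0)"
  using \<open>finite S\<close>
proof (induction S rule: finite_ranking_induct[where f = "\<lambda>b. - \<omega> b"])
  case empty
  then show ?case by simp
next
  case (insert a S)
  have hom: "module_hom scale (*) (\<beta> b)" for b
    using lin by (simp add: linear_iff_module_hom)
  note lsimps = module_hom.add[OF hom] module_hom.diff[OF hom] module_hom.scale[OF hom]
    module_hom.zero[OF hom] module_hom.sum[OF hom]
  from insert.IH obtain q where
    q: "\<And>v c. c \<in> S \<Longrightarrow> \<beta> c v = (\<Sum>b\<in>S. \<beta> b v * \<beta> c (q b))" and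
    tri: "\<And>b c. b \<in> S \<Longrightarrow> c \<in> S \<Longrightarrow> \<omega> b < \<omega> c \<Longrightarrow> \<beta> c (q b) = 0"
    by blast
  have le: "\<not> \<omega> b < \<omega> a" if "b \<in> S" for b
    using insert.hyps(2)[OF that] by simp
  show ?case
  proof (cases "a \<in> S")
    case True
    then show ?thesis using insert.IH by (simp add: insert_absorb)
  next
    case notin: False
    show ?thesis
    proof (cases "\<forall>u. (\<forall>c\<in>S. \<beta> c u = 0) \<longrightarrow> \<beta> a u = 0")
      case True
      have a: "\<beta> a v = (\<Sum>b\<in>S. \<beta> b v * \<beta> a (q b))" for v
      proof -
        have "\<beta> c (v - (\<Sum>b\<in>S. scale (\<beta> b v) (q b))) = 0" if "c \<in> S" for c
          using q[OF that, of v] by (simp add: lsimps)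
        then have "\<beta> a (v - (\<Sum>b\<in>S. scale (\<beta> b v) (q b))) = 0"
          using True by blast
        then show ?thesis by (simp add: lsimps)
      qed
      let ?q = "q(a := 0)"
      have sm: "(\<Sum>b\<in>insert a S. \<beta> b v * \<beta> c (?q b)) = (\<Sum>b\<in>S. \<beta> b v * \<beta> c (q b))" for v c
        using notin insert.hyps(1) by (auto simp: lsimps intro!: sum.cong)
      have rep: "\<beta> c v = (\<Sum>b\<in>insert a S. \<beta> b v * \<beta> c (?q b))" if "c \<in> insert a S" for c v
        unfolding sm using that a[of v] q[of c v] by blast
      have tri': "\<beta> c (?q b) = 0" if "b \<in> insert a S" "c \<in> insert a S" "\<omega> b < \<omega> c" for b c
        using that tri le by (auto simp: lsimps)
      show ?thesis
        by (intro exI[of _ ?q] conjI allI ballI impI rep tri')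
    next
      case False
      then obtain u0 where u0: "\<And>c. c \<in> S \<Longrightarrow> \<beta> c u0 = 0" "\<beta> a u0 \<noteq> 0" by blast
      define u where "u = scale (1 / \<beta> a u0) u0"
      have u: "\<And>c. c \<in> S \<Longrightarrow> \<beta> c u = 0" "\<beta> a u = 1"
        using u0 by (simp_all add: u_def lsimps)
      let ?q = "\<lambda>b. if b = a then u else q b - scale (\<beta> a (q b)) u"
      have sm: "(\<Sum>b\<in>insert a S. \<beta> b v * \<beta> c (?q b)) =
          \<beta> a v * \<beta> c u + (\<Sum>b\<in>S. \<beta> b v * (\<beta> c (q b) - \<beta> a (q b) * \<beta> c u))" for v c
        using notin insert.hyps(1) by (auto simp: lsimps intro!: sum.cong)
      have rep: "\<beta> c v = (\<Sum>b\<in>insert a S. \<beta> b v * \<beta> c (?q b))" if c: "c \<in> insert a S" for c v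
      proof (cases "c = a")
        case True
        then show ?thesis unfolding sm by (simp add: u)
      next
        case False
        with c have "c \<in> S" by simp
        then show ?thesis unfolding sm by (simp add: u) (rule q)
      qed
      have tri': "\<beta> c (?q b) = 0" if "b \<in> insert a S" "c \<in> insert a S" "\<omega> b < \<omega> c" for b c
        using that tri le u by (auto simp: lsimps)
      show ?thesis
        by (intro exI[of _ ?q] conjI allI ballI impI rep tri')
    qed
  qed
qed

section \<open>Initial degeneration of a linear space\<close>

text \<open>
  The operator \<open>\<omega>(t)\<^sup>-\<^sup>1 E \<omega>(t)\<close>. Truncating the exponent at \<open>0\<close> is harmless when \<open>E\<close> is triangular,
  and it makes the operator meaningful at \<open>t = 0\<close>, where \<open>0 ^ 0 = 1\<close> keeps the entries between
  coordinates of equal weight.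
\<close>

definition rescaled ::
    "('b::finite \<Rightarrow> int) \<Rightarrow> ('b \<Rightarrow> 'b \<Rightarrow> complex) \<Rightarrow> complex \<Rightarrow> ('b \<Rightarrow> complex) \<Rightarrow> 'b \<Rightarrow> complex" where
  "rescaled \<omega> E t x b = (\<Sum>c\<in>UNIV. E b c * t ^ nat (\<omega> c - \<omega> b) * x c)"

locale triangular_projector =
  fixes \<omega> :: "'b::finite \<Rightarrow> int" and E :: "'b \<Rightarrow> 'b \<Rightarrow> complex"
  assumes triangular: "\<omega> c < \<omega> b \<Longrightarrow> E b c = 0"
    and idempotent: "(\<Sum>c\<in>UNIV. E b c * E c d) = E b d"
begin

lemma rescaled_idempotent: "rescaled \<omega> E t (rescaled \<omega> E t x) = rescaled \<omega> E t x"
proof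
  fix b
  \<comment> \<open>The powers of \<open>t\<close> multiply as in a conjugation, since the product of entries is \<open>0\<close>
    unless \<open>\<omega> b \<le> \<omega> c \<le> \<omega> d\<close>.\<close>
  have *: "(E b c * t ^ nat (\<omega> c - \<omega> b)) * (E c d * t ^ nat (\<omega> d - \<omega> c)) =
      (E b c * E c d) * t ^ nat (\<omega> d - \<omega> b)" for c d
  proof (cases "\<omega> b \<le> \<omega> c \<and> \<omega> c \<le> \<omega> d")
    case True
    then have "nat (\<omega> d - \<omega> b) = nat (\<omega> c - \<omega> b) + nat (\<omega> d - \<omega> c)"
      by (subst nat_add_distrib[symmetric]) auto
    then show ?thesis by (simp add: power_add)
  next
    case False
    then have "E b c = 0 \<or> E c d = 0" using triangular by force
    then show ?thesis by auto
  qed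
  have "rescaled \<omega> E t (rescaled \<omega> E t x) b =
      (\<Sum>c\<in>UNIV. \<Sum>d\<in>UNIV. ((E b c * t ^ nat (\<omega> c - \<omega> b)) * (E c d * t ^ nat (\<omega> d - \<omega> c))) * x d)"
    by (simp add: rescaled_def sum_distrib_left mult_ac)
  also have "\<dots> = (\<Sum>d\<in>UNIV. (\<Sum>c\<in>UNIV. E b c * E c d) * t ^ nat (\<omega> d - \<omega> b) * x d)"
    unfolding * by (subst sum.swap) (simp add: sum_distrib_right)
  also have "\<dots> = rescaled \<omega> E t x b"
    by (simp add: idempotent rescaled_def)
  finally show "rescaled \<omega> E t (rescaled \<omega> E t x) b = rescaled \<omega> E t x b" .
qed

lemma rescaled_0: "rescaled \<omega> E 0 x b = (\<Sum>c | \<omega> c = \<omega> b. E b c * x c)"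
proof -
  have "rescaled \<omega> E 0 x b = (\<Sum>c\<in>UNIV. if \<omega> c = \<omega> b then E b c * x c else 0)"
    unfolding rescaled_def by (rule sum.cong) (auto simp: power_0_left triangular)
  then show ?thesis by (simp add: sum.If_cases)
qed

lemma rescaled_torus_action:
  assumes "t \<noteq> 0"
  shows "(\<Sum>c\<in>UNIV. E b c * (t powi \<omega> c * x c)) = t powi \<omega> b * rescaled \<omega> E t x b"
  unfolding rescaled_def sum_distrib_left
proof (rule sum.cong)
  fix c
  show "E b c * (t powi \<omega> c * x c) = t powi \<omega> b * (E b c * t ^ nat (\<omega> c - \<omega> b) * x c)"
  proof (cases "\<omega> c < \<omega> b")
    case False
    then have "t powi \<omega> c = t powi \<omega> b * t powi (\<omega> c - \<omega> b)"
      using assms by (subst power_int_add[symmetric]) auto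
    also have "t powi (\<omega> c - \<omega> b) = t ^ nat (\<omega> c - \<omega> b)"
      using False by (simp add: power_int_def)
    finally show ?thesis by (simp only: mult_ac)
  qed (simp add: triangular)
qed simp

text \<open>
  Scaling by \<open>\<omega>(t)\<close> turns the equation \<open>E y = y\<close> into \<open>E\<^sub>t x = x\<close>, so the degeneration has
  equations that are polynomial in \<open>t\<close>.
\<close>

lemma degeneration_eq:
  "degeneration \<omega> {y \<in> torus. \<forall>b. (\<Sum>c\<in>UNIV. E b c * y c) = y b} =
    {(t, x). t \<noteq> 0 \<and> x \<in> torus \<and> rescaled \<omega> E t x = x}"
  by (auto simp: degeneration_def torus_def rescaled_torus_action fun_eq_iff)

definition linear_fibre :: "('b \<Rightarrow> complex) set" where
  "linear_fibre = {x \<in> torus. rescaled \<omega> E 0 x = x}"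

abbreviation "family \<equiv> {(t, x). t \<noteq> 0 \<and> x \<in> torus \<and> rescaled \<omega> E t x = x}"

text \<open>
  Each point \<open>x\<close> of the linear fibre is the limit of the curve \<open>t \<mapsto> E\<^sub>t x\<close>, which for small \<open>t \<noteq> 0\<close> lies
  in the torus and hence in the family.
\<close>

lemma family_ideal_specializes:
  assumes "g \<in> family_ideal family"
  shows "poly g 0 \<in> torus_ideal linear_fibre"
  unfolding torus_ideal_def
proof safe
  fix x assume "x \<in> linear_fibre"
  then have x: "x \<in> torus" "rescaled \<omega> E 0 x = x"
    by (auto simp: linear_fibre_def)
  have lim: "((\<lambda>t. rescaled \<omega> E t x b) \<longlongrightarrow> x b) (at 0)" for b
  proof -
    have "((\<lambda>t. rescaled \<omega> E t x b) \<longlongrightarrow> rescaled \<omega> E 0 x b) (at 0)"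
      unfolding rescaled_def by (intro tendsto_intros)
    then show ?thesis using x by simp
  qed
  have "eventually (\<lambda>t. \<forall>b. rescaled \<omega> E t x b \<noteq> 0) (at 0)"
    using x(1) by (intro eventually_all_finite tendsto_imp_eventually_ne[OF lim]) (auto simp: torus_def)
  moreover have "eventually (\<lambda>t::complex. t \<noteq> 0) (at 0)"
    by (simp add: eventually_at_filter)
  ultimately have "eventually (\<lambda>t. family_eval t (rescaled \<omega> E t x) g = 0) (at 0)"
    by eventually_elim
       (use assms in \<open>auto simp: family_ideal_def torus_def rescaled_idempotent\<close>)
  then have "((\<lambda>t. family_eval t (rescaled \<omega> E t x) g) \<longlongrightarrow> 0) (at 0)"
    by (rule tendsto_eventually)
  moreover have "((\<lambda>t. family_eval t (rescaled \<omega> E t x) g) \<longlongrightarrow> family_eval 0 x g) (at 0)"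
    by (rule tendsto_family_eval[OF tendsto_ident_at lim x(1)])
  ultimately have "family_eval 0 x g = 0"
    using tendsto_unique[OF _ _ _, of "at (0::complex)"] by (metis at_neq_bot)
  then show "laurent_eval x (poly g 0) = 0" by (simp add: family_eval_at_0)
qed

text \<open>
  When no row of \<open>E\<^sub>0\<close> vanishes, the range of \<open>E\<^sub>0\<close> lies in no coordinate hyperplane. An explicit
  point of it off all of them is the image of a generic point \<open>(s ^ idx c)\<^sub>c\<close> of a monomial curve:
  each coordinate of this image is a nonzero polynomial in \<open>s\<close>.
\<close>

lemma linear_fibre_nonempty:
  assumes "\<And>b. \<exists>c. \<omega> c = \<omega> b \<and> E b c \<noteq> 0"
  shows "linear_fibre \<noteq> {}"
proof -
  obtain idx :: "'b \<Rightarrow> nat" where idx: "inj idx"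
    using finite_imp_inj_to_nat_seg[of "UNIV :: 'b set"] by auto
  define P where "P b = (\<Sum>c | \<omega> c = \<omega> b. monom (E b c) (idx c))" for b
  have "P b \<noteq> 0" for b
  proof -
    obtain c where c: "\<omega> c = \<omega> b" "E b c \<noteq> 0" using assms by blast
    have "coeff (P b) (idx c) = (\<Sum>d | \<omega> d = \<omega> b. if d = c then E b c else 0)"
      unfolding P_def coeff_sum
      by (rule sum.cong) (use idx in \<open>auto simp: inj_eq\<close>)
    also have "\<dots> = E b c" using c by simp
    finally show ?thesis using c(2) by force
  qed
  then have "finite (\<Union>b. {s. poly (P b) s = 0})"
    by (auto intro: poly_roots_finite)
  then obtain s where s: "\<And>b. poly (P b) s \<noteq> 0"
    using ex_new_if_finite[OF infinite_UNIV_char_0, of "\<Union>b. {s. poly (P b) s = 0}"] by blast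
  have "poly (P b) s = rescaled \<omega> E 0 (\<lambda>c. s ^ idx c) b" for b
    by (simp add: P_def rescaled_0 poly_sum poly_monom)
  with s have "rescaled \<omega> E 0 (\<lambda>c. s ^ idx c) \<in> linear_fibre"
    by (simp add: linear_fibre_def torus_def rescaled_idempotent)
  then show ?thesis by blast
qed

text \<open>
  The \<open>b\<close>-th coordinate of the substitution \<open>x \<mapsto> x + E\<^sub>0 x - E\<^sub>t x\<close>, as a polynomial in \<open>t\<close>.
\<close>

definition sheared_coordinate :: "'b \<Rightarrow> 'b laurent poly" where
  "sheared_coordinate b = monom (coordinate_term b 1) 0
     + (\<Sum>c\<in>UNIV. monom (coordinate_term c (E b c * 0 ^ nat (\<omega> c - \<omega> b))) 0)
     - (\<Sum>c\<in>UNIV. monom (coordinate_term c (E b c)) (nat (\<omega> c - \<omega> b)))"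

lemma family_eval_sheared_coordinate:
  "family_eval t x (sheared_coordinate b) = x b + rescaled \<omega> E 0 x b - rescaled \<omega> E t x b"
  by (simp add: sheared_coordinate_def family_eval_add family_eval_diff family_eval_sum
      family_eval_monom rescaled_def mult_ac)

lemma poly_sheared_coordinate_0: "poly (sheared_coordinate b) 0 = coordinate_term b 1"
proof -
  have "coordinate_term c (E b c) * 0 ^ n = coordinate_term c (E b c * 0 ^ n)" for c n
    by (cases n) auto
  then show ?thesis by (simp add: sheared_coordinate_def poly_sum poly_monom)
qed

text \<open>
  The substitution can leave the torus, where \<open>p\<close> cannot be evaluated, so \<open>p\<close> is replaced by its
  multiple by \<open>(\<Prod>b. x\<^sub>b) ^ N\<close>, which is a polynomial on all of \<open>\<complex>\<^sup>B\<close>. It vanishes on the whole range of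
  \<open>E\<^sub>0\<close> because the torus part of the range, if it is nonempty, is dense in it.
\<close>

lemma polynomial_vanishes_on_range:
  assumes p: "p \<in> torus_ideal linear_fibre" and ne: "linear_fibre \<noteq> {}"
    and N: "\<And>m b. m \<in> Poly_Mapping.keys p \<Longrightarrow> 0 \<le> m b + int N"
    and z: "rescaled \<omega> E 0 z = z"
  shows "(\<Sum>m\<in>Poly_Mapping.keys p. Poly_Mapping.lookup p m * (\<Prod>b\<in>UNIV. z b ^ nat (m b + int N))) = 0"
    (is "?P z = 0")
proof -
  have torus: "?P y = 0" if y: "y \<in> linear_fibre" for y
  proof -
    have ynz: "\<And>b. y b \<noteq> 0" using y by (auto simp: linear_fibre_def torus_def)
    have "?P y = (\<Prod>b\<in>UNIV. y b ^ N) * laurent_eval y p"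
      unfolding laurent_eval_def sum_distrib_left
    proof (rule sum.cong)
      fix m assume m: "m \<in> Poly_Mapping.keys p"
      have "y b ^ nat (m b + int N) = y b ^ N * y b powi m b" for b
      proof -
        have "y b ^ nat (m b + int N) = y b powi (m b + int N)"
          using N[OF m, of b] by (simp add: power_int_def)
        then show ?thesis using ynz[of b] by (simp add: power_int_add mult.commute)
      qed
      then show "Poly_Mapping.lookup p m * (\<Prod>b\<in>UNIV. y b ^ nat (m b + int N)) =
          (\<Prod>b\<in>UNIV. y b ^ N) * (Poly_Mapping.lookup p m * (\<Prod>b\<in>UNIV. y b powi m b))"
        by (simp add: prod.distrib)
    qed simp
    then show ?thesis using p y by (simp add: torus_ideal_def)
  qed
  \<comment> \<open>The line through \<open>z\<close> in the direction of a torus point \<open>w\<close> of the range is in the torus near \<open>z\<close>,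
    except perhaps at \<open>z\<close> itself.\<close>
  obtain w where w: "w \<in> linear_fibre" using ne by blast
  define y where "y s = (\<lambda>b. z b + s * w b)" for s
  have lim: "((\<lambda>s. y s b) \<longlongrightarrow> z b) (at 0)" for b
    unfolding y_def by (auto intro!: tendsto_eq_intros)
  have "eventually (\<lambda>s. y s b \<noteq> 0) (at 0)" for b
  proof (cases "z b = 0")
    case True
    then show ?thesis
      using w by (auto simp: y_def linear_fibre_def torus_def eventually_at_filter)
  qed (rule tendsto_imp_eventually_ne[OF lim])
  then have "eventually (\<lambda>s. \<forall>b. y s b \<noteq> 0) (at 0)"
    by (rule eventually_all_finite)
  moreover have "rescaled \<omega> E 0 (y s) = y s" for s
  proof
    fix b
    have "rescaled \<omega> E 0 (y s) b = rescaled \<omega> E 0 z b + s * rescaled \<omega> E 0 w b"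
      by (simp add: rescaled_def y_def sum_distrib_left sum.distrib algebra_simps)
    then show "rescaled \<omega> E 0 (y s) b = y s b"
      using z w by (simp add: linear_fibre_def y_def)
  qed
  ultimately have "eventually (\<lambda>s. ?P (y s) = 0) (at 0)"
    by (auto elim!: eventually_mono intro!: torus simp: linear_fibre_def torus_def)
  then have "((\<lambda>s. ?P (y s)) \<longlongrightarrow> 0) (at 0)"
    by (rule tendsto_eventually)
  moreover have "((\<lambda>s. ?P (y s)) \<longlongrightarrow> ?P z) (at 0)"
    by (intro tendsto_intros lim)
  ultimately show ?thesis
    using tendsto_unique[OF _ _ _, of "at (0::complex)"] by (metis (no_types, lifting) at_neq_bot)
qed

text \<open>
  The lift of \<open>p\<close> is \<open>p\<close> with the sheared coordinates substituted. On the family, where \<open>E\<^sub>t x = x\<close>,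
  the substituted point is \<open>E\<^sub>0 x\<close>, and \<open>p\<close>, made polynomial, vanishes there.
\<close>

lemma torus_ideal_lifts:
  assumes p: "p \<in> torus_ideal linear_fibre" and ne: "linear_fibre \<noteq> {}"
  shows "\<exists>g \<in> family_ideal family. poly g 0 = p"
proof -
  \<comment> \<open>Any bound for the absolute values of all exponents of \<open>p\<close> would do.\<close>
  define N where "N = nat (\<Sum>m\<in>Poly_Mapping.keys p. \<Sum>b\<in>UNIV. \<bar>m b\<bar>)"
  have N: "0 \<le> m b + int N" if m: "m \<in> Poly_Mapping.keys p" for m b
  proof -
    have "\<bar>m b\<bar> \<le> (\<Sum>b\<in>UNIV. \<bar>m b\<bar>)" by (rule member_le_sum) auto
    also have "\<dots> \<le> (\<Sum>m\<in>Poly_Mapping.keys p. \<Sum>b\<in>UNIV. \<bar>m b\<bar>)"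
      using m by (intro member_le_sum) (auto intro: sum_nonneg)
    finally show ?thesis unfolding N_def by linarith
  qed
  \<comment> \<open>The monomial factor undoes the multiplication of \<open>p\<close> by \<open>(\<Prod>b. x\<^sub>b) ^ N\<close>; it is a unit.\<close>
  define g where "g = monom (Poly_Mapping.single (\<lambda>_. - int N) 1) 0 *
    (\<Sum>m\<in>Poly_Mapping.keys p. monom (Poly_Mapping.single 0 (Poly_Mapping.lookup p m)) 0 *
      (\<Prod>b\<in>UNIV. sheared_coordinate b ^ nat (m b + int N)))"
  have "poly g 0 = (\<Sum>m\<in>Poly_Mapping.keys p. Poly_Mapping.single (\<lambda>_. - int N) 1 *
      (Poly_Mapping.single 0 (Poly_Mapping.lookup p m) *
        (\<Prod>b\<in>UNIV. coordinate_term b 1 ^ nat (m b + int N))))"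
    by (simp add: g_def poly_sum poly_prod poly_sheared_coordinate_0 sum_distrib_left poly_monom)
  also have "\<dots> = (\<Sum>m\<in>Poly_Mapping.keys p. Poly_Mapping.single m (Poly_Mapping.lookup p m))"
    by (rule sum.cong)
       (auto simp: prod_coordinate_term_power mult_single fun_eq_iff N
             intro!: arg_cong2[where f = Poly_Mapping.single])
  also have "\<dots> = p" by (rule sum_single_lookup)
  finally have "poly g 0 = p" .
  moreover have "g \<in> family_ideal family"
    unfolding family_ideal_def
  proof safe
    fix t x assume "t \<noteq> 0" and x: "x \<in> torus" and fix_x: "rescaled \<omega> E t x = x"
    let ?z = "rescaled \<omega> E 0 x"
    have "(\<Sum>m\<in>Poly_Mapping.keys p. Poly_Mapping.lookup p m *
        (\<Prod>b\<in>UNIV. ?z b ^ nat (m b + int N))) = 0"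
      by (rule polynomial_vanishes_on_range[OF p ne]) (simp_all add: N rescaled_idempotent)
    then show "family_eval t x g = 0"
      using fix_x
      by (simp add: g_def family_eval_mult[OF x] family_eval_sum family_eval_monom
          family_eval_prod[OF x] family_eval_power[OF x] family_eval_sheared_coordinate)
  qed
  ultimately show ?thesis by blast
qed

text \<open>
  The equations \<open>(E\<^sub>0 x)\<^sub>b = x\<^sub>b\<close> of the linear fibre are themselves Laurent polynomials.
\<close>

lemma linear_fibre_zariski_closed:
  assumes "x \<in> torus" "\<And>p. p \<in> torus_ideal linear_fibre \<Longrightarrow> laurent_eval x p = 0"
  shows "x \<in> linear_fibre"
proof -
  have "rescaled \<omega> E 0 x b = x b" for b
  proof -
    define p where "p = (\<Sum>c\<in>UNIV. coordinate_term c (E b c * 0 ^ nat (\<omega> c - \<omega> b))) - coordinate_term b 1"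
    have eval: "laurent_eval y p = rescaled \<omega> E 0 y b - y b" for y
      by (simp add: p_def laurent_eval_diff laurent_eval_sum rescaled_def)
    then have "p \<in> torus_ideal linear_fibre"
      by (simp add: torus_ideal_def linear_fibre_def)
    then show ?thesis using assms(2)[of p] eval by simp
  qed
  with assms(1) show ?thesis by (auto simp: linear_fibre_def)
qed

theorem initial_degeneration_of_range:
  fixes X :: "('b \<Rightarrow> complex) set"
  assumes X: "X = {y \<in> torus. \<forall>b. (\<Sum>c\<in>UNIV. E b c * y c) = y b}" and ne: "linear_fibre \<noteq> {}"
  shows "initial_ideal \<omega> X = torus_ideal linear_fibre"
    and "initial_points \<omega> X = linear_fibre"
proof -
  show ideal: "initial_ideal \<omega> X = torus_ideal linear_fibre"
    unfolding initial_ideal_def X degeneration_eq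
    using family_ideal_specializes torus_ideal_lifts[OF _ ne] by blast
  have "initial_points \<omega> X = {x \<in> torus. \<forall>p\<in>initial_ideal \<omega> X. laurent_eval x p = 0}"
    by (auto simp: initial_points_def zariski_closure_def initial_ideal_def family_eval_at_0)
  also have "\<dots> = linear_fibre"
    unfolding ideal using linear_fibre_zariski_closed
    by (auto simp: torus_ideal_def linear_fibre_def)
  finally show "initial_points \<omega> X = linear_fibre" .
qed

end

section \<open>The complement of a flag of flats\<close>

text \<open>
  Replaces cosets by representatives: a form that vanishes on \<open>L'\<close> takes on the coset of \<open>u\<close> the single
  value that it takes at \<open>u\<close>.
\<close>

lemma complement_image_quotient:
  fixes f :: "'b \<Rightarrow> 'v::ab_group_add \<Rightarrow> complex"
  assumes diff: "\<And>b u v. f b (u - v) = f b u - f b v" and zero: "0 \<in> L'"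
    and vanish: "\<And>b v. b \<in> S \<Longrightarrow> v \<in> L' \<Longrightarrow> f b v = 0"
  shows "complement_image (quotient_space L L') S (\<lambda>b. induced_form (f b)) =
    {restrict (\<lambda>b. f b u) S | u. u \<in> L \<and> (\<forall>b\<in>S. f b u \<noteq> 0)}"
proof -
  let ?r = "{(u, v). u \<in> L \<and> v \<in> L \<and> u - v \<in> L'}"
  have ind: "induced_form (f b) (?r `` {u}) = f b u" if "u \<in> L" "b \<in> S" for u b
  proof -
    have "f b v = f b u" if "v \<in> ?r `` {u}" for v
      using vanish[OF \<open>b \<in> S\<close>, of "u - v"] that by (simp add: diff)
    moreover have "u \<in> ?r `` {u}" using that zero by simp
    ultimately have "f b ` (?r `` {u}) = {f b u}" by blast
    then show ?thesis by (simp add: induced_form_def)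
  qed
  have restr: "restrict (\<lambda>b. induced_form (f b) (?r `` {u})) S = restrict (\<lambda>b. f b u) S"
    if "u \<in> L" for u
    using ind[OF that] by (simp add: restrict_def fun_eq_iff)
  have "complement_image (quotient_space L L') S (\<lambda>b. induced_form (f b)) =
      {restrict (\<lambda>b. induced_form (f b) (?r `` {u})) S | u.
        u \<in> L \<and> (\<forall>b\<in>S. induced_form (f b) (?r `` {u}) \<noteq> 0)}"
    unfolding complement_image_def arrangement_complement_def hyperplane_def quotient_space_def
      quotient_def by blast
  also have "\<dots> = {restrict (\<lambda>b. f b u) S | u. u \<in> L \<and> (\<forall>b\<in>S. f b u \<noteq> 0)}"
    using ind restr by (intro Collect_cong ex_cong1) (metis (no_types, lifting))
  finally show ?thesis .
qed

lemma flat_eq_common_kernel: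
  assumes "is_flat \<beta> (L i)"
  shows "L i = {v. \<forall>b\<in>flag_forms \<beta> L i. \<beta> b v = 0}"
proof -
  obtain A where A: "A \<subseteq> range (\<lambda>b. hyperplane UNIV (\<beta> b))" "L i = \<Inter>A"
    using assms by (auto simp: is_flat_def)
  show ?thesis
  proof (intro set_eqI iffI)
    fix v assume "v \<in> {v. \<forall>b\<in>flag_forms \<beta> L i. \<beta> b v = 0}"
    moreover have "b \<in> flag_forms \<beta> L i" if "hyperplane UNIV (\<beta> b) \<in> A" for b
      using that A(2) by (auto simp: flag_forms_def hyperplane_def)
    ultimately have "v \<in> hyperplane UNIV (\<beta> b)" if "hyperplane UNIV (\<beta> b) \<in> A" for b
      using that by (simp add: hyperplane_def)
    then have "v \<in> H" if "H \<in> A" for H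
      using that A(1) by auto
    then show "v \<in> L i" using A(2) by simp
  qed (auto simp: flag_forms_def)
qed

lemma flag_mono:
  assumes "is_flag \<beta> k L" "i \<le> j" "j \<le> k + 1"
  shows "L i \<subseteq> L j"
  using assms(2,3)
proof (induction j rule: dec_induct)
  case (step n)
  then have "L n \<subset> L (n + 1)" using assms(1) by (simp add: is_flag_def)
  with step show ?case by auto
qed simp

text \<open>
  A nonzero form vanishes on \<open>L 0\<close> and not on \<open>L (k + 1)\<close>; its block is given by the first member of
  the flag on which it does not vanish.
\<close>

lemma flag_block_exists:
  assumes flag: "is_flag \<beta> k L" and b: "\<beta> b 0 = 0" "\<beta> b \<noteq> (\<lambda>v. 0)"
  shows "\<exists>i\<in>{1..k + 1}. b \<in> flag_block \<beta> L i"
proof -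
  have 0: "b \<in> flag_forms \<beta> L 0" and "b \<notin> flag_forms \<beta> L (k + 1)"
    using flag b by (auto simp: is_flag_def flag_forms_def)
  define i where "i = (LEAST i. b \<notin> flag_forms \<beta> L i)"
  have i: "b \<notin> flag_forms \<beta> L i" "i \<le> k + 1"
    unfolding i_def using \<open>b \<notin> flag_forms \<beta> L (k + 1)\<close> by (rule LeastI, rule Least_le)
  with 0 have "i \<noteq> 0" by metis
  then have "b \<in> flag_forms \<beta> L (i - 1)"
    using not_less_Least[of "i - 1" "\<lambda>i. b \<notin> flag_forms \<beta> L i"] by (auto simp: i_def)
  with i \<open>i \<noteq> 0\<close> show ?thesis by (auto simp: flag_block_def)
qed

lemma flag_forms_antimono:
  assumes "is_flag \<beta> k L" "i \<le> j" "j \<le> k + 1"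
  shows "flag_forms \<beta> L j \<subseteq> flag_forms \<beta> L i"
  using flag_mono[OF assms] by (auto simp: flag_forms_def)

text \<open>
  Strictness of the flag passes to the forms because a flat is determined by the forms vanishing on it.
\<close>

lemma flag_block_nonempty:
  assumes flag: "is_flag \<beta> k L" and i: "i \<in> {1..k + 1}"
  shows "flag_block \<beta> L i \<noteq> {}"
proof
  assume "flag_block \<beta> L i = {}"
  moreover have "flag_forms \<beta> L i \<subseteq> flag_forms \<beta> L (i - 1)"
    using flag_forms_antimono[OF flag] i by simp
  ultimately have forms: "flag_forms \<beta> L i = flag_forms \<beta> L (i - 1)"
    by (auto simp: flag_block_def)
  have flats: "is_flat \<beta> (L j)" if "j \<le> i" for j
    using flag i that by (simp add: is_flag_def)
  have "L i = {v. \<forall>b\<in>flag_forms \<beta> L i. \<beta> b v = 0}"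
    by (rule flat_eq_common_kernel[OF flats]) simp
  also have "\<dots> = L (i - 1)"
    unfolding forms by (rule flat_eq_common_kernel[OF flats, symmetric]) simp
  finally have "L i = L (i - 1)" .
  moreover from i obtain j where "i = j + 1" "j \<le> k" by (cases i) auto
  then have "L (i - 1) \<subset> L i" using flag by (simp add: is_flag_def)
  ultimately show False by simp
qed

text \<open>
  The cone compares only consecutive blocks; since no block is empty, the comparisons chain.
\<close>

lemma weight_strictly_increasing:
  assumes flag: "is_flag \<beta> k L" and \<omega>: "\<omega> \<in> flag_cone_relint \<beta> k L"
    and "i < j" "1 \<le> i" "j \<le> k + 1" and b: "b \<in> flag_block \<beta> L i" and "c \<in> flag_block \<beta> L j"
  shows "\<omega> b < \<omega> c"
proof -
  have "Suc i \<le> j" using \<open>i < j\<close> by simp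
  then show ?thesis
    using \<open>j \<le> k + 1\<close> \<open>c \<in> flag_block \<beta> L j\<close>
  proof (induction j arbitrary: c rule: dec_induct)
    case base
    then show ?case using \<omega> b \<open>1 \<le> i\<close> by (simp add: flag_cone_relint_def)
  next
    case (step n)
    obtain d where d: "d \<in> flag_block \<beta> L n"
      using flag_block_nonempty[OF flag, of n] step.hyps step.prems by auto
    have "n \<in> {1..k}" "c \<in> flag_block \<beta> L (n + 1)"
      using step.hyps step.prems by simp_all
    then have "\<omega> d < \<omega> c"
      using \<omega> d unfolding flag_cone_relint_def by blast
    moreover have "\<omega> b < \<omega> d" using step.IH[of d] d step.prems by simp
    ultimately show ?case by simp
  qed
qed

text \<open>
  Weights increase from block to block and the blocks exhaust the nonzero forms, so comparing weights
  is the same as comparing positions in the flag.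
\<close>

lemma weight_determines_flag:
  assumes flag: "is_flag \<beta> k L" and \<omega>: "\<omega> \<in> flag_cone_relint \<beta> k L"
    and nz: "\<And>b. \<beta> b 0 = 0" "\<And>b. \<beta> b \<noteq> (\<lambda>v. 0)"
    and i: "i \<in> {1..k + 1}" and b: "b \<in> flag_block \<beta> L i"
  shows "flag_forms \<beta> L i = {c. \<omega> b < \<omega> c}" and "flag_block \<beta> L i = {c. \<omega> c = \<omega> b}"
proof -
  have "(c \<in> flag_forms \<beta> L i \<longleftrightarrow> \<omega> b < \<omega> c) \<and> (c \<in> flag_block \<beta> L i \<longleftrightarrow> \<omega> c = \<omega> b)" for c
  proof -
    obtain j where j: "j \<in> {1..k + 1}" "c \<in> flag_block \<beta> L j"
      using flag_block_exists[OF flag nz] by blast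
    consider "i < j" | "i = j" | "j < i" by linarith
    then show ?thesis
    proof cases
      case 1
      then have "\<omega> b < \<omega> c"
        using weight_strictly_increasing[OF flag \<omega> _ _ _ b j(2)] i j(1) by simp
      moreover have "c \<in> flag_forms \<beta> L i"
        using flag_forms_antimono[OF flag, of i "j - 1"] 1 j unfolding flag_block_def by force
      ultimately show ?thesis by (auto simp: flag_block_def)
    next
      case 2
      then have "\<omega> c = \<omega> b" using \<omega> i b j(2) unfolding flag_cone_relint_def by blast
      then show ?thesis using j 2 by (auto simp: flag_block_def)
    next
      case 3
      then have "\<omega> c < \<omega> b"
        using weight_strictly_increasing[OF flag \<omega> _ _ _ j(2) b] i j(1) by simp
      moreover have "c \<notin> flag_forms \<beta> L (i - 1)"
        using flag_forms_antimono[OF flag, of j "i - 1"] 3 i j unfolding flag_block_def by force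
      moreover have "c \<notin> flag_forms \<beta> L i"
        using flag_forms_antimono[OF flag, of j i] 3 i j by (auto simp: flag_block_def)
      ultimately show ?thesis by (auto simp: flag_block_def)
    qed
  qed
  then show "flag_forms \<beta> L i = {c. \<omega> b < \<omega> c}" "flag_block \<beta> L i = {c. \<omega> c = \<omega> b}"
    by blast+
qed

lemma flag_complement_blockwise:
  assumes flag: "is_flag \<beta> k L" and diff: "\<And>b u v. \<beta> b (u - v) = \<beta> b u - \<beta> b v"
    and zero: "\<And>b. \<beta> b 0 = 0"
  shows "x \<in> flag_complement \<beta> k L \<longleftrightarrow>
    (\<forall>i\<in>{1..k + 1}. \<exists>u\<in>L i. \<forall>b\<in>flag_block \<beta> L i. x b = \<beta> b u \<and> x b \<noteq> 0)"
proof -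
  have "restrict x (flag_block \<beta> L i) \<in> complement_image (quotient_space (L i) (L (i - 1)))
        (flag_block \<beta> L i) (\<lambda>b. induced_form (\<beta> b)) \<longleftrightarrow>
      (\<exists>u\<in>L i. \<forall>b\<in>flag_block \<beta> L i. x b = \<beta> b u \<and> x b \<noteq> 0)" if i: "i \<in> {1..k + 1}" for i
  proof -
    have "0 \<in> L (i - 1)"
      using flag_mono[OF flag, of 0 "i - 1"] flag i by (auto simp: is_flag_def)
    then have "complement_image (quotient_space (L i) (L (i - 1)))
        (flag_block \<beta> L i) (\<lambda>b. induced_form (\<beta> b)) =
        {restrict (\<lambda>b. \<beta> b u) (flag_block \<beta> L i) | u. u \<in> L i \<and> (\<forall>b\<in>flag_block \<beta> L i. \<beta> b u \<noteq> 0)}"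
      by (intro complement_image_quotient diff) (auto simp: flag_block_def flag_forms_def)
    moreover have "restrict x S = restrict (\<lambda>b. \<beta> b u) S \<longleftrightarrow> (\<forall>b\<in>S. x b = \<beta> b u)" for S u
      by (auto simp: restrict_def fun_eq_iff)
    ultimately show ?thesis by fastforce
  qed
  then show ?thesis by (simp add: flag_complement_def)
qed

theorem lemma2p5:
  fixes scale :: "complex \<Rightarrow> 'v::ab_group_add \<Rightarrow> 'v"
    and Basis :: "'v set"
    and \<beta> :: "'b::finite \<Rightarrow> 'v \<Rightarrow> complex"
    and k :: nat
    and L :: "nat \<Rightarrow> 'v set"
    and \<omega> :: "'b \<Rightarrow> int"
  assumes "finite_dimensional_vector_space scale Basis"
    and "\<And>b. \<beta> b \<in> dual scale"
    and "\<And>b. \<beta> b \<noteq> (\<lambda>v. 0)"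
    and "dual_span (range \<beta>) = dual scale"
    and "is_flag \<beta> k L"
    and "(\<lambda>b. real_of_int (\<omega> b)) \<in> flag_cone_relint \<beta> k L"
  shows "initial_points \<omega> (complement_image UNIV UNIV \<beta>) = flag_complement \<beta> k L \<and>
         initial_ideal \<omega> (complement_image UNIV UNIV \<beta>) = torus_ideal (flag_complement \<beta> k L)"
proof -
  note nz = assms(3) and flag = assms(5) and cone = assms(6)
  have lin: "Vector_Spaces.linear scale (*) (\<beta> b)" for b
    using assms(2) by (simp add: dual_def)
  then have hom: "module_hom scale (*) (\<beta> b)" for b
    by (simp add: linear_iff_module_hom)
  have zero: "\<beta> b 0 = 0" and diff: "\<beta> b (u - v) = \<beta> b u - \<beta> b v" for b u v
    using module_hom.zero[OF hom] module_hom.diff[OF hom] by auto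
  have comb: "\<beta> b (\<Sum>c\<in>S. scale (x c) (f c)) = (\<Sum>c\<in>S. x c * \<beta> b (f c))" for b S x and f :: "'b \<Rightarrow> 'v"
    by (simp add: module_hom.sum[OF hom] module_hom.scale[OF hom])

  obtain q where q: "(\<forall>v. \<forall>c\<in>UNIV. \<beta> c v = (\<Sum>b\<in>UNIV. \<beta> b v * \<beta> c (q b))) \<and>
      (\<forall>b\<in>UNIV. \<forall>c\<in>UNIV. \<omega> b < \<omega> c \<longrightarrow> \<beta> c (q b) = 0)"
    using triangular_dual_frame[where \<beta> = \<beta> and \<omega> = \<omega> and S = UNIV, OF lin finite] by blast
  then have frame: "\<beta> b v = (\<Sum>c\<in>UNIV. \<beta> c v * \<beta> b (q c))"
    and tri: "\<omega> c < \<omega> b \<Longrightarrow> \<beta> b (q c) = 0" for b c v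
    by blast+
  define E where "E b c = \<beta> b (q c)" for b c
  have apply_E: "(\<Sum>c\<in>UNIV. E b c * \<beta> c v) = \<beta> b v" for b v
    using frame[where b = b and v = v] by (simp add: E_def mult.commute)
  interpret triangular_projector \<omega> E
  proof
    show "E b c = 0" if "\<omega> c < \<omega> b" for b c
      using tri[OF that] by (simp add: E_def)
    show "(\<Sum>c\<in>UNIV. E b c * E c d) = E b d" for b d
      using apply_E[of b "q d"] by (simp add: E_def)
  qed

  have block_forms: "flag_forms \<beta> L i = {c. \<omega> b < \<omega> c}"
    and block: "flag_block \<beta> L i = {c. \<omega> c = \<omega> b}"
    if "i \<in> {1..k + 1}" "b \<in> flag_block \<beta> L i" for i b
    using weight_determines_flag[OF flag cone zero nz that] by auto
  have block_exists: "\<exists>i\<in>{1..k + 1}. b \<in> flag_block \<beta> L i" for b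
    by (rule flag_block_exists[OF flag zero nz])

  \<comment> \<open>For vectors of \<open>L i\<close> the identity \<open>E \<beta>(u) = \<beta>(u)\<close> involves, in the rows of the \<open>i\<close>-th block, only
    that block: forms of larger weight vanish on \<open>L i\<close>, and smaller weights are excluded by triangularity.\<close>
  have on_flat: "\<beta> b u = (\<Sum>c | \<omega> c = \<omega> b. E b c * \<beta> c u)"
    if i: "i \<in> {1..k + 1}" and b: "b \<in> flag_block \<beta> L i" and u: "u \<in> L i" for i b u
  proof -
    have "E b c * \<beta> c u = 0" if "\<omega> c \<noteq> \<omega> b" for c
    proof (cases "\<omega> c < \<omega> b")
      case False
      then have "c \<in> flag_forms \<beta> L i" using that block_forms[OF i b] by simp
      then show ?thesis using u by (simp add: flag_forms_def)
    qed (simp add: triangular)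
    then have "(\<Sum>c | \<omega> c = \<omega> b. E b c * \<beta> c u) = (\<Sum>c\<in>UNIV. E b c * \<beta> c u)"
      by (intro sum.mono_neutral_left) auto
    then show ?thesis by (simp add: apply_E)
  qed

  have range: "complement_image UNIV UNIV \<beta> = {y \<in> torus. \<forall>b. (\<Sum>c\<in>UNIV. E b c * y c) = y b}"
  proof (intro set_eqI iffI)
    fix y assume "y \<in> complement_image UNIV UNIV \<beta>"
    then show "y \<in> {y \<in> torus. \<forall>b. (\<Sum>c\<in>UNIV. E b c * y c) = y b}"
      by (auto simp: complement_image_def arrangement_complement_def hyperplane_def torus_def apply_E)
  next
    fix y assume y: "y \<in> {y \<in> torus. \<forall>b. (\<Sum>c\<in>UNIV. E b c * y c) = y b}"
    let ?v = "\<Sum>c\<in>UNIV. scale (y c) (q c)"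
    have val: "\<beta> b ?v = y b" for b
      using y by (auto simp: comb E_def mult.commute)
    have "y = (\<lambda>b. \<beta> b ?v)"
      by (simp add: val)
    moreover have "?v \<in> arrangement_complement UNIV UNIV \<beta>"
      using y by (simp add: arrangement_complement_def hyperplane_def torus_def val)
    ultimately show "y \<in> complement_image UNIV UNIV \<beta>"
      unfolding complement_image_def restrict_UNIV by blast
  qed

  have fibre: "flag_complement \<beta> k L = linear_fibre"
  proof (intro set_eqI iffI)
    fix x assume "x \<in> flag_complement \<beta> k L"
    then have x: "\<exists>u\<in>L i. \<forall>b\<in>flag_block \<beta> L i. x b = \<beta> b u \<and> x b \<noteq> 0" if "i \<in> {1..k + 1}" for i
      using that flag_complement_blockwise[OF flag diff zero] by blast
    have "x b \<noteq> 0 \<and> rescaled \<omega> E 0 x b = x b" for b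
    proof -
      obtain i where i: "i \<in> {1..k + 1}" "b \<in> flag_block \<beta> L i" using block_exists by blast
      obtain u where u: "u \<in> L i" "\<And>c. c \<in> flag_block \<beta> L i \<Longrightarrow> x c = \<beta> c u \<and> x c \<noteq> 0"
        using x[OF i(1)] by blast
      have "rescaled \<omega> E 0 x b = (\<Sum>c | \<omega> c = \<omega> b. E b c * \<beta> c u)"
        unfolding rescaled_0 by (rule sum.cong) (use u(2) block[OF i] in auto)
      also have "\<dots> = x b"
        using on_flat[OF i u(1)] u(2)[OF i(2)] by simp
      finally show ?thesis using u(2)[OF i(2)] by blast
    qed
    then show "x \<in> linear_fibre" by (auto simp: linear_fibre_def torus_def)
  next
    fix x assume "x \<in> linear_fibre"
    then have x: "x b \<noteq> 0" "(\<Sum>c | \<omega> c = \<omega> b. E b c * x c) = x b" for b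
      by (auto simp: linear_fibre_def torus_def fun_eq_iff simp flip: rescaled_0)
    have "\<exists>u\<in>L i. \<forall>b\<in>flag_block \<beta> L i. x b = \<beta> b u \<and> x b \<noteq> 0" if i: "i \<in> {1..k + 1}" for i
    proof (rule bexI)
      \<comment> \<open>The frame vectors of the \<open>i\<close>-th block lie in \<open>L i\<close>, since \<open>L i\<close> is the common kernel of the forms
        of larger weight.\<close>
      let ?u = "\<Sum>c\<in>flag_block \<beta> L i. scale (x c) (q c)"
      show "\<forall>b\<in>flag_block \<beta> L i. x b = \<beta> b ?u \<and> x b \<noteq> 0"
      proof
        fix b assume "b \<in> flag_block \<beta> L i"
        then show "x b = \<beta> b ?u \<and> x b \<noteq> 0"
          using x[of b] block[OF i, of b] by (simp add: comb E_def mult.commute)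
      qed
      have "\<beta> b (q c) = 0" if "b \<in> flag_forms \<beta> L i" "c \<in> flag_block \<beta> L i" for b c
        using that block_forms[OF i that(2)] by (simp add: tri)
      then have "\<beta> b ?u = 0" if "b \<in> flag_forms \<beta> L i" for b
        using that by (simp add: comb)
      moreover have "is_flat \<beta> (L i)" using flag i by (simp add: is_flag_def)
      ultimately show "?u \<in> L i" by (subst flat_eq_common_kernel) auto
    qed
    then show "x \<in> flag_complement \<beta> k L"
      using flag_complement_blockwise[OF flag diff zero] by blast
  qed

  \<comment> \<open>A form of the \<open>i\<close>-th block does not vanish on \<open>L i\<close>, so its row of \<open>E\<^sub>0\<close> is not zero.\<close>
  have "\<exists>c. \<omega> c = \<omega> b \<and> E b c \<noteq> 0" for b
  proof -
    obtain i where i: "i \<in> {1..k + 1}" "b \<in> flag_block \<beta> L i" using block_exists by blast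
    then obtain u where "u \<in> L i" "\<beta> b u \<noteq> 0"
      by (auto simp: flag_block_def flag_forms_def)
    then have "(\<Sum>c | \<omega> c = \<omega> b. E b c * \<beta> c u) \<noteq> 0" using on_flat[OF i] by simp
    then show ?thesis by (rule sum.not_neutral_contains_not_neutral) auto
  qed
  then have "linear_fibre \<noteq> {}" by (rule linear_fibre_nonempty)
  from initial_degeneration_of_range[OF range this] show ?thesis
    unfolding fibre by simp
qed

end
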